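(* Let $A,B$ be the matrices defined in the context (uniform grid, Dirichlet boundary conditions), and let $$\widetilde C=(|w_{-1}|-10w_2)(\alpha+\beta)-(r+\lambda),\qquad \widehat C=\widetilde C+\lambda\sqrt{L_y\|f\|_\infty}.$$ Let $V^{n+1}$ be given by the Crank--Nicolson scheme $$(I-\tfrac12\Delta tA)V^{n+1}=(I+\tfrac12\Delta tA)V^n+\tfrac12\Delta t(BV^n+BV^{n+1})+\tfrac12\Delta t(g_n+g_{n+1}),$$ let $Y_\ell$ ($\ell\ge1$) be given by the fixed-point iteration (CNFI scheme) $$(I-\tfrac12\Delta tA)Y_\ell=(I+\tfrac12\Delta tA)V^n+\tfrac12\Delta t(BV^n+BY_{\ell-1})+\tfrac12\Delta t(g_n+g_{n+1}),$$ and set $\varepsilon_\ell=V^{n+1}-Y_\ell$. If $\widehat C\Delta t<2$, then the CNFI iterates converge to the Crank--Nicolson solution in the $\ell_2$-norm (i.e. $\|\varepsilon_\ell\|_2\to0$ as $\ell\to\infty$) and, for all $\ell\ge1$, $$\|\varepsilon_\ell\|_2\le\Theta\,\|\varepsilon_{\ell-1}\|_2\quad\text{with}\quad\Theta=\frac{\tfrac12\Delta t\,\lambda\sqrt{L_y\|f\|_\infty}}{1-\tfrac12\Delta t\,\widetilde C}<1.$$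
   Context: Parameters: $\alpha,\beta,\sigma,\lambda,\Delta t>0$, $\mu,r\in\mathbb R$; $f$ is a bounded probability density on $\mathbb R$, $\|f\|_\infty=\sup_{\xi}|f(\xi)|<\infty$, $L_y=y_{\max}-y_{\min}$. The real weights satisfy $\sum_{k=-1}^2w_k=0$, $\sum_{k=-1}^2kw_k=1$, $\sum_{k=-1}^2k^2w_k=0$, $w_2\le0$. Grid: $x_{\min}=x_{-1}<x_0<\dots<x_{m_1}<x_{m_1+1}=x_{\max}$ and $y_{\min}=y_{-1}<y_0<\dots<y_{m_2}<y_{m_2+1}=y_{\max}$ are uniform meshes with widths $\Delta x,\Delta y$. The unknowns are $V=(V_{i,j})_{0\le i\le m_1,0\le j\le m_2}$ (entry $i(m_2+1)+j$); values at indices $-1$, $m_1+1$ (in $i$) and $-1$, $m_2+1$ (in $j$) are prescribed Dirichlet data. $I$ is the identity. Put $a_i=\alpha(\mu-x_i)$, $b_j=-\beta y_j$, $c^+=\max(c,0)$, $c^-=\min(c,0)$. Standing assumption: $a(x)=\alpha(\mu-x)$ and $b(y)=-\beta y$ change sign within the domain, being positive near $x_{\min},y_{\min}$ and negative near $x_{\max},y_{\max}$: $a_0>0>a_{m_1}$, $b_0>0>b_{m_2}$ (so no stencil below extends beyond the boundary nodes). The matrices $A,B$ are obtained from the following formulas by setting all boundary values equal to zero: $(AV)_{i,j}=\frac{\sigma^2}{2}\frac{V_{i-1,j}-2V_{i,j}+V_{i+1,j}}{\Delta x^2}-(r+\lambda)V_{i,j}+a_i^+\frac{w_2V_{i+2,j}+w_1V_{i+1,j}+w_0V_{i,j}+w_{-1}V_{i-1,j}}{\Delta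 x}+a_i^-\frac{-w_{-1}V_{i+1,j}-w_0V_{i,j}-w_1V_{i-1,j}-w_2V_{i-2,j}}{\Delta x}+b_j^+\frac{w_2V_{i,j+2}+w_1V_{i,j+1}+w_0V_{i,j}+w_{-1}V_{i,j-1}}{\Delta y}+b_j^-\frac{-w_{-1}V_{i,j+1}-w_0V_{i,j}-w_1V_{i,j-1}-w_2V_{i,j-2}}{\Delta y},$ $(BV)_{i,j}=\lambda\sum_{\ell=-1}^{m_2}\int_{y_\ell}^{y_{\ell+1}}\Big(\frac{y_{\ell+1}-\xi}{\Delta y}V_{i,\ell}+\frac{\xi-y_\ell}{\Delta y}V_{i,\ell+1}\Big)f(\xi-y_j)\,d\xi.$ The vector $g(t)$ collects the contributions of the boundary values in these formulas, and $g_n=g(n\Delta t)$. $V^n$ (and $V^{n-1}$ if $n\ge1$) are the given approximations at earlier time levels; the starting vector is $Y_0=2V^n-V^{n-1}$ if $n\ge1$ and $Y_0=V^0$ if $n=0$. The norm is $\|V\|_2=\sqrt{\langle V,V\rangle}$ with $\langle U,V\rangle=\Delta x\Delta y\sum_kU_kV_k$. *)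

theory Defs
  imports
    "HOL-Analysis.Analysis"
    "Jordan_Normal_Form.Matrix"
begin

text \<open>
  Grid functions are maps \<open>int \<Rightarrow> int \<Rightarrow> real\<close>. On the index range \<open>-1..m1+1\<close>, \<open>-1..m2+1\<close> they carry
  the unknowns at the interior nodes \<open>0..m1\<close>, \<open>0..m2\<close> and the Dirichlet data at the remaining ones.
\<close>

definition interior_node :: "nat \<Rightarrow> nat \<Rightarrow> int \<Rightarrow> int \<Rightarrow> bool" where
  "interior_node m1 m2 i j \<longleftrightarrow> 0 \<le> i \<and> i \<le> int m1 \<and> 0 \<le> j \<and> j \<le> int m2"

definition grid_dim :: "nat \<Rightarrow> nat \<Rightarrow> nat" where
  "grid_dim m1 m2 = (m1 + 1) * (m2 + 1)"

definition grid_vec :: "nat \<Rightarrow> nat \<Rightarrow> (int \<Rightarrow> int \<Rightarrow> real) \<Rightarrow> real Matrix.vec" where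
  "grid_vec m1 m2 U =
     Matrix.vec (grid_dim m1 m2) (\<lambda>k. U (int (k div (m2 + 1))) (int (k mod (m2 + 1))))"

definition zero_ext :: "nat \<Rightarrow> nat \<Rightarrow> real Matrix.vec \<Rightarrow> int \<Rightarrow> int \<Rightarrow> real" where
  "zero_ext m1 m2 V i j =
     (if interior_node m1 m2 i j then vec_index V (nat i * (m2 + 1) + nat j) else 0)"

definition boundary_ext :: "nat \<Rightarrow> nat \<Rightarrow> (int \<Rightarrow> int \<Rightarrow> real) \<Rightarrow> int \<Rightarrow> int \<Rightarrow> real" where
  "boundary_ext m1 m2 \<phi> i j = (if interior_node m1 m2 i j then 0 else \<phi> i j)"

text \<open>
  With \<open>a 0 > 0 > a m1\<close> and \<open>b 0 > 0 > b m2\<close>, every value at an index outside \<open>-1..m1+1\<close> or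
  \<open>-1..m2+1\<close> is multiplied by a vanishing coefficient.
\<close>

definition diff_op ::
  "(int \<Rightarrow> real) \<Rightarrow> real \<Rightarrow> real \<Rightarrow> real \<Rightarrow> (int \<Rightarrow> real) \<Rightarrow> (int \<Rightarrow> real) \<Rightarrow> real \<Rightarrow> real \<Rightarrow>
   (int \<Rightarrow> int \<Rightarrow> real) \<Rightarrow> int \<Rightarrow> int \<Rightarrow> real" where
  "diff_op w \<sigma> r lam a b dx dy V i j =
     \<sigma>\<^sup>2 / 2 * ((V (i-1) j - 2 * V i j + V (i+1) j) / dx\<^sup>2)
   - (r + lam) * V i j
   + max (a i) 0 *
       ((w 2 * V (i+2) j + w 1 * V (i+1) j + w 0 * V i j + w (-1) * V (i-1) j) / dx)
   + min (a i) 0 *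
       ((- w (-1) * V (i+1) j - w 0 * V i j - w 1 * V (i-1) j - w 2 * V (i-2) j) / dx)
   + max (b j) 0 *
       ((w 2 * V i (j+2) + w 1 * V i (j+1) + w 0 * V i j + w (-1) * V i (j-1)) / dy)
   + min (b j) 0 *
       ((- w (-1) * V i (j+1) - w 0 * V i j - w 1 * V i (j-1) - w 2 * V i (j-2)) / dy)"

definition jump_op ::
  "real \<Rightarrow> (real \<Rightarrow> real) \<Rightarrow> (int \<Rightarrow> real) \<Rightarrow> real \<Rightarrow> nat \<Rightarrow>
   (int \<Rightarrow> int \<Rightarrow> real) \<Rightarrow> int \<Rightarrow> int \<Rightarrow> real" where
  "jump_op lam f y dy m2 V i j =
     lam * (\<Sum>l\<in>{-1..int m2}. LINT \<xi>:{y l..y (l+1)}|lebesgue.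
              ((y (l+1) - \<xi>) / dy * V i l + (\<xi> - y l) / dy * V i (l+1)) * f (\<xi> - y j))"

text \<open>The matrix representing a linear operator on grid functions with zero boundary values.\<close>

definition grid_mat ::
  "nat \<Rightarrow> nat \<Rightarrow> ((int \<Rightarrow> int \<Rightarrow> real) \<Rightarrow> int \<Rightarrow> int \<Rightarrow> real) \<Rightarrow> real Matrix.mat" where
  "grid_mat m1 m2 T = Matrix.mat (grid_dim m1 m2) (grid_dim m1 m2)
     (\<lambda>(k, l). T (zero_ext m1 m2 (unit_vec (grid_dim m1 m2) l))
                (int (k div (m2 + 1))) (int (k mod (m2 + 1))))"

definition grid_norm :: "real \<Rightarrow> real \<Rightarrow> real Matrix.vec \<Rightarrow> real" where
  "grid_norm dx dy V = sqrt (dx * dy * scalar_prod V V)"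

definition prob_density :: "(real \<Rightarrow> real) \<Rightarrow> bool" where
  "prob_density f \<longleftrightarrow> (\<forall>\<xi>. 0 \<le> f \<xi>) \<and> has_bochner_integral lebesgue f 1"

lemma grid_mat_mult:
  assumes V: "V \<in> carrier_vec (grid_dim m1 m2)"
    and add: "\<And>U W i j. T (\<lambda>i j. U i j + W i j) i j = T U i j + T W i j"
    and scale: "\<And>c U i j. T (\<lambda>i j. c * U i j) i j = c * T U i j"
  shows "grid_mat m1 m2 T *\<^sub>v V = grid_vec m1 m2 (T (zero_ext m1 m2 V))"
proof -
  let ?N = "grid_dim m1 m2"
  have zero: "T (\<lambda>i j. 0) i j = 0" for i j
    using scale[of 0 "\<lambda>i j. 0" i j] by simp
  have sum: "T (\<lambda>i j. \<Sum>l\<in>S. c l * U l i j) i j = (\<Sum>l\<in>S. c l * T (U l) i j)"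
    if "finite S" for S :: "nat set" and c U i j
    using that
  proof (induction S rule: finite_induct)
    case empty
    then show ?case by (simp add: zero)
  next
    case (insert l S)
    then show ?case
      using add[of "\<lambda>i j. c l * U l i j" "\<lambda>i j. \<Sum>l\<in>S. c l * U l i j" i j] scale[of "c l" "U l" i j]
      by simp
  qed
  have decomp: "zero_ext m1 m2 V =
      (\<lambda>i j. \<Sum>l\<in>{0..<?N}. vec_index V l * zero_ext m1 m2 (unit_vec ?N l) i j)"
  proof (intro ext)
    fix i j
    show "zero_ext m1 m2 V i j =
        (\<Sum>l\<in>{0..<?N}. vec_index V l * zero_ext m1 m2 (unit_vec ?N l) i j)"
    proof (cases "interior_node m1 m2 i j")
      case True
      let ?k = "nat i * (m2 + 1) + nat j"
      have "nat j < m2 + 1" "nat i \<le> m1"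
        using True by (auto simp: interior_node_def)
      then have "?k < nat i * (m2 + 1) + (m2 + 1)" by simp
      also have "\<dots> = (nat i + 1) * (m2 + 1)" by simp
      also have "\<dots> \<le> ?N"
        unfolding grid_dim_def using \<open>nat i \<le> m1\<close> by (intro mult_right_mono) auto
      finally have k: "?k < ?N" .
      have "vec_index V l * zero_ext m1 m2 (unit_vec ?N l) i j = (if ?k = l then vec_index V l else 0)"
        if "l \<in> {0..<?N}" for l
        using True k that by (simp add: zero_ext_def unit_vec_def)
      then show ?thesis
        using True k by (simp add: zero_ext_def)
    next
      case False
      then show ?thesis by (simp add: zero_ext_def)
    qed
  qed
  show ?thesis
  proof (rule eq_vecI)
    fix k
    assume "k < dim_vec (grid_vec m1 m2 (T (zero_ext m1 m2 V)))"
    then have k: "k < ?N" by (simp add: grid_vec_def)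
    have "T (zero_ext m1 m2 V) i j =
        (\<Sum>l\<in>{0..<?N}. vec_index V l * T (zero_ext m1 m2 (unit_vec ?N l)) i j)" for i j
      by (subst decomp) (rule sum, simp)
    then show "vec_index (grid_mat m1 m2 T *\<^sub>v V) k =
        vec_index (grid_vec m1 m2 (T (zero_ext m1 m2 V))) k"
      using k V by (simp add: grid_mat_def grid_vec_def scalar_prod_def mult.commute)
  qed (simp add: grid_mat_def grid_vec_def)
qed

lemma grid_mat_diff_op:
  assumes "V \<in> carrier_vec (grid_dim m1 m2)"
  shows "grid_mat m1 m2 (diff_op w \<sigma> r lam a b dx dy) *\<^sub>v V =
    grid_vec m1 m2 (diff_op w \<sigma> r lam a b dx dy (zero_ext m1 m2 V))"
proof (rule grid_mat_mult[OF assms])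
  show "diff_op w \<sigma> r lam a b dx dy (\<lambda>i j. U i j + W i j) i j =
      diff_op w \<sigma> r lam a b dx dy U i j + diff_op w \<sigma> r lam a b dx dy W i j" for U W i j
    by (simp add: diff_op_def add_divide_distrib diff_divide_distrib distrib_left right_diff_distrib)
  show "diff_op w \<sigma> r lam a b dx dy (\<lambda>i j. c * U i j) i j =
      c * diff_op w \<sigma> r lam a b dx dy U i j" for c U i j
    by (simp add: diff_op_def add_divide_distrib diff_divide_distrib distrib_left right_diff_distrib
        mult.left_commute)
qed

lemma grid_mat_jump_op:
  assumes "V \<in> carrier_vec (grid_dim m1 m2)" and f: "prob_density f"
  shows "grid_mat m1 m2 (jump_op lam f y dy m2) *\<^sub>v V =
    grid_vec m1 m2 (jump_op lam f y dy m2 (zero_ext m1 m2 V))"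
proof (rule grid_mat_mult[OF assms(1)])
  have f_int: "integrable lebesgue (\<lambda>\<xi>. f (\<xi> - s))" for s
    using lebesgue_integrable_real_affine[of f 1 "-s"] f
    by (simp add: prob_density_def has_bochner_integral_iff)
  have int: "set_integrable lebesgue {p..q} (\<lambda>\<xi>. ((p' - \<xi>) / dy * u + (\<xi> - q') / dy * v) * f (\<xi> - s))"
    for p q p' q' u v s
  proof (rule absolutely_integrable_bounded_measurable_product_real)
    have cont: "continuous_on {p..q} (\<lambda>\<xi>. (p' - \<xi>) / dy * u + (\<xi> - q') / dy * v)"
      unfolding divide_inverse by (intro continuous_intros)
    then show "(\<lambda>\<xi>. (p' - \<xi>) / dy * u + (\<xi> - q') / dy * v) \<in> borel_measurable (lebesgue_on {p..q})"
      by (intro continuous_imp_measurable_on_sets_lebesgue) auto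
    show "bounded ((\<lambda>\<xi>. (p' - \<xi>) / dy * u + (\<xi> - q') / dy * v) ` {p..q})"
      using compact_continuous_image[OF cont] compact_imp_bounded by auto
    show "set_integrable lebesgue {p..q} (\<lambda>\<xi>. f (\<xi> - s))"
      unfolding set_integrable_def by (rule integrable_mult_indicator[OF _ f_int]) auto
  qed auto
  have eq: "(LINT \<xi>:{p..q}|lebesgue. ((p' - \<xi>) / dy * (u + u') + (\<xi> - q') / dy * (v + v')) * f (\<xi> - s)) =
      (LINT \<xi>:{p..q}|lebesgue. ((p' - \<xi>) / dy * u + (\<xi> - q') / dy * v) * f (\<xi> - s)) +
      (LINT \<xi>:{p..q}|lebesgue. ((p' - \<xi>) / dy * u' + (\<xi> - q') / dy * v') * f (\<xi> - s))"
    for p q p' q' u v u' v' s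
    by (subst set_integral_add(2)[OF int int, symmetric]) (simp add: algebra_simps add_divide_distrib diff_divide_distrib)
  show "jump_op lam f y dy m2 (\<lambda>i j. U i j + W i j) i j =
      jump_op lam f y dy m2 U i j + jump_op lam f y dy m2 W i j" for U W i j
    unfolding jump_op_def eq by (simp add: sum.distrib distrib_left)
  have eq2: "((p - \<xi>) / dy * (c * u) + (\<xi> - q) / dy * (c * v)) * t =
      c * (((p - \<xi>) / dy * u + (\<xi> - q) / dy * v) * t)" for p q \<xi> c u v t
    by (simp add: algebra_simps)
  show "jump_op lam f y dy m2 (\<lambda>i j. c * U i j) i j = c * jump_op lam f y dy m2 U i j" for c U i j
    unfolding jump_op_def eq2 by (simp add: sum_distrib_left mult.left_commute)
qed

end

theory Submission
  imports Defs
begin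

text \<open>
  The order conditions leave one free weight: with \<open>s = - w 2 \<ge> 0\<close> the upwind stencil is the central
  difference plus \<open>s\<close> times a third difference. Summation by parts bounds the central part by
  \<open>\<alpha> / 2 * \<parallel>V\<parallel>\<^sup>2\<close>, since only the slope of the coefficient survives. The third difference is
  dissipative for a constant coefficient; as the positive and the negative part of the coefficient
  are again Lipschitz, each costs at most \<open>3 * s * \<alpha> * \<parallel>V\<parallel>\<^sup>2\<close>. Hence \<open>\<langle>V, A V\<rangle> \<le> C_tilde * \<parallel>V\<parallel>\<^sup>2\<close>.
  Each row of \<open>B / lam\<close> is a subprobability average of the grid values with weights at most
  \<open>dy * f_sup\<close>, so Jensen's inequality and summation over the rows give
  \<open>\<parallel>B V\<parallel> \<le> lam * sqrt (L_y * f_sup) * \<parallel>V\<parallel>\<close>. Pairing \<open>(I - dt/2 A) \<epsilon>\<^sub>l = dt/2 B \<epsilon>\<^sub>l\<^sub>-\<^sub>1\<close> with \<open>\<epsilon>\<^sub>l\<close>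
  then yields the contraction.
\<close>

section \<open>Summation by parts for finitely supported sequences\<close>

text \<open>Sequences vanishing off a finite interval leave no boundary terms under summation by
  parts. \<open>T\<close> is any window covering the shifted support, so differently shifted sums
  can share one range.\<close>

lemma sum_int_shift:
  fixes h :: "int \<Rightarrow> real"
  assumes supp: "\<And>i. i \<notin> {lo..hi} \<Longrightarrow> h i = 0" and T: "finite T" "{lo - k..hi - k} \<subseteq> T"
  shows "(\<Sum>i\<in>T. h (i + k)) = sum h {lo..hi}"
proof -
  have "(\<Sum>i\<in>T. h (i + k)) = (\<Sum>i\<in>{lo - k..hi - k}. h (i + k))"
    using T by (intro sum.mono_neutral_right) (auto intro!: supp)
  also have "\<dots> = sum h {lo..hi}"
    by (rule sum.reindex_bij_witness[of _ "\<lambda>i. i - k" "\<lambda>i. i + k"]) auto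
  finally show ?thesis .
qed

lemma sum_int_reflect:
  fixes h :: "int \<Rightarrow> real"
  shows "(\<Sum>i\<in>{0..m}. h (m - i)) = sum h {0..m}"
  by (rule sum.reindex_bij_witness[of _ "\<lambda>i. m - i" "\<lambda>i. m - i"]) auto

text \<open>With constant \<open>c\<close> the left side telescopes up to a nonpositive remainder.
  With variable \<open>c\<close>, Abel summation moves the difference of \<open>P\<close> onto
  \<open>c\<close>, leaving a quadratic form weighted by increments of size at most
  \<open>K\<close>.\<close>

lemma sum_third_difference_le:
  fixes c v :: "int \<Rightarrow> real"
  assumes supp: "\<And>i. i \<notin> {0..m} \<Longrightarrow> v i = 0"
    and nonneg: "\<And>i. 0 \<le> c i"
    and lip: "\<And>i. \<bar>c i - c (i - 1)\<bar> \<le> K"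
  shows "(\<Sum>i\<in>{0..m}. c i * v i * (v (i-1) - 3 * v i + 3 * v (i+1) - v (i+2)))
    \<le> 3 * K * (\<Sum>i\<in>{0..m}. (v i)\<^sup>2)"
proof -
  \<comment> \<open>The window is wide enough for the support of \<open>P\<close> and for that
    support moved one place to the left.\<close>
  let ?T = "{-2..m+2}"
  define P where "P i = (v (i-1))\<^sup>2 / 2 - (v i)\<^sup>2 / 2 - v (i-1) * v i + v (i-1) * v (i+1)" for i
  have K: "0 \<le> K" using lip[of 0] by linarith
  have P0: "P i = 0" if "i \<notin> {-1..m+1}" for i
    using that by (auto simp: P_def supp)
  have "(\<Sum>i\<in>{0..m}. c i * v i * (v (i-1) - 3 * v i + 3 * v (i+1) - v (i+2)))
      = (\<Sum>i\<in>?T. c i * v i * (v (i-1) - 3 * v i + 3 * v (i+1) - v (i+2)))"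
    by (rule sum.mono_neutral_left) (auto intro!: supp)
  \<comment> \<open>The symbol of the third difference has real part \<open>- 2 * (1 - cos \<theta>)\<^sup>2\<close>, so its pairing with \<open>v\<close>
    is minus half a squared second difference, up to the telescoping form \<open>P\<close>.\<close>
  also have "\<dots> \<le> (\<Sum>i\<in>?T. c i * (P i - P (i+1)))"
  proof (rule sum_mono)
    fix i
    have "v i * (v (i-1) - 3 * v i + 3 * v (i+1) - v (i+2))
        = P i - P (i+1) - (v (i-1) - 2 * v i + v (i+1))\<^sup>2 / 2"
      by (simp add: P_def power2_eq_square field_simps)
    also have "\<dots> \<le> P i - P (i+1)" by simp
    finally show "c i * v i * (v (i-1) - 3 * v i + 3 * v (i+1) - v (i+2)) \<le> c i * (P i - P (i+1))"
      using nonneg[of i] by (simp add: mult_left_mono mult.assoc)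
  qed
  \<comment> \<open>Writing the index as \<open>i + 1 - 1\<close> exhibits the second sum as the
    shift by 1 of \<open>c (i-1) * P i\<close>.\<close>
  also have "\<dots> = (\<Sum>i\<in>?T. c i * P i) - (\<Sum>i\<in>?T. c (i + 1 - 1) * P (i+1))"
    by (simp add: right_diff_distrib sum_subtractf)
  also have "(\<Sum>i\<in>?T. c (i + 1 - 1) * P (i+1)) = (\<Sum>i\<in>{-1..m+1}. c (i-1) * P i)"
    by (rule sum_int_shift[where h = "\<lambda>i. c (i-1) * P i"]) (auto simp: P0)
  also have "(\<Sum>i\<in>?T. c i * P i) = (\<Sum>i\<in>{-1..m+1}. c i * P i)"
    by (rule sum.mono_neutral_right) (auto intro!: P0)
  also have "(\<Sum>i\<in>{-1..m+1}. c i * P i) - (\<Sum>i\<in>{-1..m+1}. c (i-1) * P i)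
      = (\<Sum>i\<in>{-1..m+1}. (c i - c (i-1)) * P i)"
    by (simp add: sum_subtractf left_diff_distrib)
  also have "\<dots> \<le> (\<Sum>i\<in>{-1..m+1}. K * (3/2 * (v (i + -1))\<^sup>2 + (v i)\<^sup>2 + (v (i+1))\<^sup>2 / 2))"
  proof (rule sum_mono)
    fix i
    \<comment> \<open>Young's inequality on the two cross terms. The three shifted sums of squares
      coincide, so the coefficients 3/2, 1 and 1/2 add up to the 3 of the conclusion.\<close>
    have "\<bar>P i\<bar> \<le> 3/2 * (v (i-1))\<^sup>2 + (v i)\<^sup>2 + (v (i+1))\<^sup>2 / 2"
    proof (rule abs_leI)
      have "0 \<le> (v (i-1) + v i)\<^sup>2 / 2 + (v (i-1) - v (i+1))\<^sup>2 / 2 + (v i)\<^sup>2"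
        by simp
      then show "P i \<le> 3/2 * (v (i-1))\<^sup>2 + (v i)\<^sup>2 + (v (i+1))\<^sup>2 / 2"
        using zero_le_power2[of "v i"] by (simp add: P_def power2_eq_square field_simps)
      have "0 \<le> (v (i-1) - v i)\<^sup>2 / 2 + (v (i-1) + v (i+1))\<^sup>2 / 2 + (v (i-1))\<^sup>2"
        by simp
      then show "- P i \<le> 3/2 * (v (i-1))\<^sup>2 + (v i)\<^sup>2 + (v (i+1))\<^sup>2 / 2"
        by (simp add: P_def power2_eq_square field_simps)
    qed
    then have "\<bar>c i - c (i-1)\<bar> * \<bar>P i\<bar> \<le> K * (3/2 * (v (i-1))\<^sup>2 + (v i)\<^sup>2 + (v (i+1))\<^sup>2 / 2)"
      using lip[of i] K by (intro mult_mono) auto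
    then show "(c i - c (i-1)) * P i \<le> K * (3/2 * (v (i + -1))\<^sup>2 + (v i)\<^sup>2 + (v (i+1))\<^sup>2 / 2)"
      unfolding abs_mult[symmetric] by simp
  qed
  also have "\<dots> = K * (3/2 * (\<Sum>i\<in>{-1..m+1}. (v (i + -1))\<^sup>2) + (\<Sum>i\<in>{-1..m+1}. (v (i + 0))\<^sup>2)
      + (\<Sum>i\<in>{-1..m+1}. (v (i+1))\<^sup>2) / 2)"
    by (simp only: sum_distrib_left[symmetric] sum.distrib sum_divide_distrib[symmetric] add_0_right)
  also have "\<dots> = 3 * K * (\<Sum>i\<in>{0..m}. (v i)\<^sup>2)"
  proof -
    have "(\<Sum>i\<in>{-1..m+1}. (v (i + k))\<^sup>2) = (\<Sum>i\<in>{0..m}. (v i)\<^sup>2)" if "k \<in> {-1,0,1}" for k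
      using that by (intro sum_int_shift[where h = "\<lambda>i. (v i)\<^sup>2"]) (auto simp: supp)
    from this[of "-1"] this[of 0] this[of 1] show ?thesis by (simp add: algebra_simps)
  qed
  finally show ?thesis .
qed

text \<open>The reflection \<open>i\<close> to \<open>m - i\<close> preserves \<open>{0..m}\<close>
  and carries this mirrored stencil to the previous one, with the same Lipschitz bound on the
  coefficient.\<close>

lemma sum_third_difference_reflected_le:
  fixes c v :: "int \<Rightarrow> real"
  assumes supp: "\<And>i. i \<notin> {0..m} \<Longrightarrow> v i = 0"
    and nonneg: "\<And>i. 0 \<le> c i"
    and lip: "\<And>i. \<bar>c i - c (i - 1)\<bar> \<le> K"
  shows "(\<Sum>i\<in>{0..m}. c i * v i * (v (i+1) - 3 * v i + 3 * v (i-1) - v (i-2)))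
    \<le> 3 * K * (\<Sum>i\<in>{0..m}. (v i)\<^sup>2)"
proof -
  have "\<bar>c (m - i) - c (m - (i - 1))\<bar> \<le> K" for i
    using lip[of "m - (i - 1)"] by (simp add: abs_minus_commute algebra_simps)
  then have "(\<Sum>i\<in>{0..m}. c (m-i) * v (m-i) * (v (m-(i-1)) - 3 * v (m-i) + 3 * v (m-(i+1)) - v (m-(i+2))))
      \<le> 3 * K * (\<Sum>i\<in>{0..m}. (v (m-i))\<^sup>2)"
    by (intro sum_third_difference_le[where c = "\<lambda>i. c (m - i)" and v = "\<lambda>i. v (m - i)"])
       (auto intro!: supp nonneg)
  moreover have "(\<Sum>i\<in>{0..m}. c (m-i) * v (m-i) * (v (m-(i-1)) - 3 * v (m-i) + 3 * v (m-(i+1)) - v (m-(i+2))))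
      = (\<Sum>i\<in>{0..m}. c i * v i * (v (i+1) - 3 * v i + 3 * v (i-1) - v (i-2)))"
    by (subst sum_int_reflect[symmetric]) (simp add: algebra_simps)
  ultimately show ?thesis
    using sum_int_reflect[of "\<lambda>i. (v i)\<^sup>2" m] by simp
qed

lemma sum_neighbours_le:
  fixes v :: "int \<Rightarrow> real"
  assumes supp: "\<And>i. i \<notin> {0..m} \<Longrightarrow> v i = 0"
  shows "(\<Sum>i\<in>{-1..m}. v i * v (i+1)) \<le> (\<Sum>i\<in>{0..m}. (v i)\<^sup>2)"
proof -
  \<comment> \<open>Starting at -1 makes the range cover the support of \<open>v\<close> both
    unshifted and shifted by 1, so both sums of squares are complete.\<close>
  have "(\<Sum>i\<in>{-1..m}. v i * v (i+1)) \<le> (\<Sum>i\<in>{-1..m}. ((v (i + 0))\<^sup>2 + (v (i+1))\<^sup>2) / 2)"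
  proof (rule sum_mono)
    fix i
    show "v i * v (i+1) \<le> ((v (i + 0))\<^sup>2 + (v (i+1))\<^sup>2) / 2"
      using sum_squares_bound[of "v i" "v (i+1)"] by simp
  qed
  also have "\<dots> = ((\<Sum>i\<in>{-1..m}. (v (i + 0))\<^sup>2) + (\<Sum>i\<in>{-1..m}. (v (i+1))\<^sup>2)) / 2"
    by (simp only: sum.distrib sum_divide_distrib[symmetric])
  also have "\<dots> = (\<Sum>i\<in>{0..m}. (v i)\<^sup>2)"
  proof -
    have "(\<Sum>i\<in>{-1..m}. (v (i + k))\<^sup>2) = (\<Sum>i\<in>{0..m}. (v i)\<^sup>2)" if "k \<in> {0,1}" for k
      using that by (intro sum_int_shift[where h = "\<lambda>i. (v i)\<^sup>2"]) (auto simp: supp)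
    from this[of 0] this[of 1] show ?thesis by simp
  qed
  finally show ?thesis .
qed

text \<open>The central difference is skew-symmetric, so for constant \<open>a\<close> the sum is
  zero. For affine \<open>a\<close> only the decrement \<open>K\<close> survives, paired with
  products of neighbours.\<close>

lemma sum_central_difference_le:
  fixes a v :: "int \<Rightarrow> real"
  assumes supp: "\<And>i. i \<notin> {0..m} \<Longrightarrow> v i = 0"
    and step: "\<And>i. a i - a (i + 1) = K" and K: "0 \<le> K"
  shows "(\<Sum>i\<in>{0..m}. a i * v i * (v (i+1) - v (i-1))) \<le> K * (\<Sum>i\<in>{0..m}. (v i)\<^sup>2)"
proof -
  have "(\<Sum>i\<in>{0..m}. a i * v i * (v (i+1) - v (i-1)))
      = (\<Sum>i\<in>{0..m}. a i * v i * v (i+1)) - (\<Sum>i\<in>{0..m}. a i * v i * v (i-1))"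
    by (simp add: right_diff_distrib sum_subtractf)
  also have "(\<Sum>i\<in>{0..m}. a i * v i * v (i+1)) = (\<Sum>i\<in>{-1..m}. a i * v i * v (i+1))"
    by (rule sum.mono_neutral_left) (auto simp: supp)
  also have "(\<Sum>i\<in>{0..m}. a i * v i * v (i-1)) = (\<Sum>i\<in>{-1..m}. a (i+1) * v (i+1) * v (i+1-1))"
    by (rule sum_int_shift[where h = "\<lambda>i. a i * v i * v (i-1)", symmetric]) (auto simp: supp)
  also have "(\<Sum>i\<in>{-1..m}. a i * v i * v (i+1)) - (\<Sum>i\<in>{-1..m}. a (i+1) * v (i+1) * v (i+1-1))
      = (\<Sum>i\<in>{-1..m}. (a i - a (i+1)) * (v i * v (i+1)))"
    by (simp add: sum_subtractf[symmetric] algebra_simps)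
  also have "\<dots> = K * (\<Sum>i\<in>{-1..m}. v i * v (i+1))"
    by (simp add: step sum_distrib_left)
  also have "\<dots> \<le> K * (\<Sum>i\<in>{0..m}. (v i)\<^sup>2)"
    using K sum_neighbours_le[of m v] supp by (intro mult_left_mono) auto
  finally show ?thesis .
qed

text \<open>Negative semidefiniteness of the discrete Laplacian with zero Dirichlet values; the two
  neighbour sums are at most the diagonal.\<close>

lemma sum_second_difference_le:
  fixes v :: "int \<Rightarrow> real"
  assumes supp: "\<And>i. i \<notin> {0..m} \<Longrightarrow> v i = 0"
  shows "(\<Sum>i\<in>{0..m}. v i * (v (i-1) - 2 * v i + v (i+1))) \<le> 0"
proof -
  have "(\<Sum>i\<in>{0..m}. v i * (v (i-1) - 2 * v i + v (i+1)))
      = (\<Sum>i\<in>{0..m}. v i * v (i-1)) + (\<Sum>i\<in>{0..m}. v i * v (i+1)) - 2 * (\<Sum>i\<in>{0..m}. (v i)\<^sup>2)"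
    by (simp add: sum.distrib[symmetric] sum_subtractf[symmetric] sum_distrib_left algebra_simps power2_eq_square)
  also have "(\<Sum>i\<in>{0..m}. v i * v (i+1)) = (\<Sum>i\<in>{-1..m}. v i * v (i+1))"
    by (rule sum.mono_neutral_left) (auto simp: supp)
  also have "(\<Sum>i\<in>{0..m}. v i * v (i-1)) = (\<Sum>i\<in>{-1..m}. v (i+1) * v (i+1-1))"
    by (rule sum_int_shift[where h = "\<lambda>i. v i * v (i-1)", symmetric]) (auto simp: supp)
  finally show ?thesis
    using sum_neighbours_le[of m v] supp by (simp add: mult.commute)
qed

section \<open>Energy estimate for the differential part\<close>

text \<open>The moment conditions are three linear equations in four weights, solved here with
  \<open>w 2\<close> free. The value 0 gives the central difference, and -1/6 the third-order
  upwind-biased stencil.\<close>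

lemma third_order_weights:
  fixes w :: "int \<Rightarrow> real"
  assumes "(\<Sum>k\<in>{-1..2::int}. w k) = 0"
    and "(\<Sum>k\<in>{-1..2::int}. of_int k * w k) = 1"
    and "(\<Sum>k\<in>{-1..2::int}. of_int k ^ 2 * w k) = 0"
  shows "w (-1) = - w 2 - 1/2" "w 0 = 3 * w 2" "w 1 = 1/2 - 3 * w 2"
proof -
  have "{-1..2::int} = {-1,0,1,2}" by auto
  with assms show "w (-1) = - w 2 - 1/2" "w 0 = 3 * w 2" "w 1 = 1/2 - 3 * w 2"
    by auto
qed

text \<open>One-dimensional convection stencil, kept undivided by the mesh width so that a single
  estimate serves both coordinate directions.\<close>

definition upwind :: "(int \<Rightarrow> real) \<Rightarrow> (int \<Rightarrow> real) \<Rightarrow> (int \<Rightarrow> real) \<Rightarrow> int \<Rightarrow> real" where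
  "upwind w a v i =
     max (a i) 0 * (w 2 * v (i+2) + w 1 * v (i+1) + w 0 * v i + w (-1) * v (i-1))
   + min (a i) 0 * (- w (-1) * v (i+1) - w 0 * v i - w 1 * v (i-1) - w 2 * v (i-2))"

lemma sum_upwind_le:
  fixes a v :: "int \<Rightarrow> real"
  assumes w: "w (-1) = - w 2 - 1/2" "w 0 = 3 * w 2" "w 1 = 1/2 - 3 * w 2" "w 2 \<le> 0"
    and supp: "\<And>i. i \<notin> {0..m} \<Longrightarrow> v i = 0"
    and step: "\<And>i. a i - a (i + 1) = K" and K: "0 \<le> K"
  shows "(\<Sum>i\<in>{0..m}. v i * upwind w a v i) \<le> (\<bar>w (-1)\<bar> - 10 * w 2) * K * (\<Sum>i\<in>{0..m}. (v i)\<^sup>2)"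
proof -
  let ?S = "\<Sum>i\<in>{0..m}. (v i)\<^sup>2"
  \<comment> \<open>Since the positive and negative parts of \<open>a i\<close> add up to
    \<open>a i\<close>, the central differences of both stencils merge. The third differences stay
    separate, each with a nonnegative coefficient.\<close>
  have split: "v i * upwind w a v i = 1/2 * (a i * v i * (v (i+1) - v (i-1)))
     + (- w 2) * (max (a i) 0 * v i * (v (i-1) - 3 * v i + 3 * v (i+1) - v (i+2)))
     + (- w 2) * (- min (a i) 0 * v i * (v (i+1) - 3 * v i + 3 * v (i-1) - v (i-2)))" for i
  proof (cases "0 \<le> a i")
    case True
    then show ?thesis
      by (simp add: upwind_def w(1-3) max_absorb1 min_absorb2 field_simps)
  next
    case False
    then show ?thesis
      by (simp add: upwind_def w(1-3) max_absorb2 min_absorb1 field_simps)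
  qed
  \<comment> \<open>Taking positive or negative parts does not increase the increments, so both
    third-difference bounds apply with this \<open>K\<close>.\<close>
  have st: "a (i - 1) - a i = K" for i using step[of "i - 1"] by simp
  have 1: "(\<Sum>i\<in>{0..m}. a i * v i * (v (i+1) - v (i-1))) \<le> K * ?S"
    using supp step K by (rule sum_central_difference_le)
  have 2: "(\<Sum>i\<in>{0..m}. max (a i) 0 * v i * (v (i-1) - 3 * v i + 3 * v (i+1) - v (i+2))) \<le> 3 * K * ?S"
  proof (rule sum_third_difference_le[OF supp])
    show "\<bar>max (a i) 0 - max (a (i - 1)) 0\<bar> \<le> K" for i using st[of i] K by linarith
  qed auto
  have 3: "(\<Sum>i\<in>{0..m}. - min (a i) 0 * v i * (v (i+1) - 3 * v i + 3 * v (i-1) - v (i-2))) \<le> 3 * K * ?S"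
  proof (rule sum_third_difference_reflected_le[OF supp])
    show "\<bar>- min (a i) 0 - - min (a (i - 1)) 0\<bar> \<le> K" for i using st[of i] K by linarith
  qed auto
  have "(\<Sum>i\<in>{0..m}. v i * upwind w a v i)
      = 1/2 * (\<Sum>i\<in>{0..m}. a i * v i * (v (i+1) - v (i-1)))
     + (- w 2) * (\<Sum>i\<in>{0..m}. max (a i) 0 * v i * (v (i-1) - 3 * v i + 3 * v (i+1) - v (i+2)))
     + (- w 2) * (\<Sum>i\<in>{0..m}. - min (a i) 0 * v i * (v (i+1) - 3 * v i + 3 * v (i-1) - v (i-2)))"
    unfolding split sum.distrib sum_distrib_left ..
  also have "\<dots> \<le> 1/2 * (K * ?S) + (- w 2) * (3 * K * ?S) + (- w 2) * (3 * K * ?S)"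
    using 1 2 3 w(4) by (intro add_mono mult_left_mono) auto
  also have "\<dots> = (1/2 - 6 * w 2) * (K * ?S)"
    by (simp add: algebra_simps)
  \<comment> \<open>Here \<open>\<bar>w (-1)\<bar>\<close> is at least
    \<open>- w (-1) = w 2 + 1/2\<close>, so the right factor is at least
    \<open>1/2 - 9 * w 2\<close>, which dominates because \<open>w 2\<close> is nonpositive.\<close>
  also have "\<dots> \<le> (\<bar>w (-1)\<bar> - 10 * w 2) * (K * ?S)"
    using w(1,4) K by (intro mult_right_mono) (auto intro!: mult_nonneg_nonneg sum_nonneg)
  finally show ?thesis by (simp add: mult.assoc)
qed

lemma diff_op_upwind:
  "diff_op w \<sigma> r lam a b dx dy V i j =
     \<sigma>\<^sup>2 / 2 / dx\<^sup>2 * (V (i-1) j - 2 * V i j + V (i+1) j) - (r + lam) * V i j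
   + upwind w a (\<lambda>i. V i j) i / dx + upwind w b (V i) j / dy"
proof -
  have "(p * q + p' * q') / d = p * (q / d) + p' * (q' / d)" for p q p' q' d :: real
    by (simp add: add_divide_distrib)
  then show ?thesis
    unfolding diff_op_def upwind_def by simp
qed

text \<open>The estimates are applied along grid lines. The increments \<open>\<alpha> * dx\<close>
  and \<open>\<beta> * dy\<close> cancel the mesh widths in the denominators, so the bound is
  independent of the mesh; diffusion only helps.\<close>

lemma diff_op_energy_le:
  fixes V :: "int \<Rightarrow> int \<Rightarrow> real"
  assumes w: "w (-1) = - w 2 - 1/2" "w 0 = 3 * w 2" "w 1 = 1/2 - 3 * w 2" "w 2 \<le> 0"
    and supp: "\<And>i j. \<not> interior_node m1 m2 i j \<Longrightarrow> V i j = 0"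
    and step: "\<And>i. a i - a (i + 1) = \<alpha> * dx" "\<And>j. b j - b (j + 1) = \<beta> * dy"
    and pos: "0 \<le> \<alpha>" "0 \<le> \<beta>" "0 < dx" "0 < dy"
  shows "(\<Sum>i\<in>{0..int m1}. \<Sum>j\<in>{0..int m2}. V i j * diff_op w \<sigma> r lam a b dx dy V i j)
    \<le> ((\<bar>w (-1)\<bar> - 10 * w 2) * (\<alpha> + \<beta>) - (r + lam)) * (\<Sum>i\<in>{0..int m1}. \<Sum>j\<in>{0..int m2}. (V i j)\<^sup>2)"
proof -
  let ?I = "{0..int m1}" and ?J = "{0..int m2}"
  let ?W = "\<bar>w (-1)\<bar> - 10 * w 2"
  let ?S = "\<Sum>i\<in>?I. \<Sum>j\<in>?J. (V i j)\<^sup>2"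
  let ?D = "\<lambda>i j. V i j * (V (i-1) j - 2 * V i j + V (i+1) j)"
  have si: "V i j = 0" if "i \<notin> ?I" for i j using that by (auto intro!: supp simp: interior_node_def)
  have sj: "V i j = 0" if "j \<notin> ?J" for i j using that by (auto intro!: supp simp: interior_node_def)
  have swap: "(\<Sum>i\<in>?I. \<Sum>j\<in>?J. F i j) = (\<Sum>j\<in>?J. \<Sum>i\<in>?I. F i j)" for F :: "int \<Rightarrow> int \<Rightarrow> real"
    by (rule sum.swap)
  \<comment> \<open>For differences in the first index the sums are swapped, so that the inner sum
    runs along a line of fixed \<open>j\<close>.\<close>
  have 1: "(\<Sum>i\<in>?I. \<Sum>j\<in>?J. ?D i j) \<le> 0"
    unfolding swap by (intro sum_nonpos sum_second_difference_le si)
  have 2: "(\<Sum>i\<in>?I. \<Sum>j\<in>?J. V i j * upwind w a (\<lambda>i. V i j) i) \<le> ?W * (\<alpha> * dx) * ?S"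
    unfolding swap sum_distrib_left[of "?W * (\<alpha> * dx)" _ ?J] using pos
    by (intro sum_mono sum_upwind_le w si step) auto
  have 3: "(\<Sum>i\<in>?I. \<Sum>j\<in>?J. V i j * upwind w b (V i) j) \<le> ?W * (\<beta> * dy) * ?S"
    unfolding sum_distrib_left[of "?W * (\<beta> * dy)" _ ?I] using pos
    by (intro sum_mono sum_upwind_le w sj step) auto
  have split: "V i j * diff_op w \<sigma> r lam a b dx dy V i j =
      \<sigma>\<^sup>2 / 2 / dx\<^sup>2 * ?D i j - (r + lam) * (V i j)\<^sup>2
      + (V i j * upwind w a (\<lambda>i. V i j) i) / dx + (V i j * upwind w b (V i) j) / dy" for i j
  proof -
    have "v * (c * d - e * v + p / x + q / y) = c * (v * d) - e * v\<^sup>2 + (v * p) / x + (v * q) / y"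
      for v c d e p q x y :: real
      by (simp add: algebra_simps power2_eq_square)
    then show ?thesis unfolding diff_op_upwind .
  qed
  have "(\<Sum>i\<in>?I. \<Sum>j\<in>?J. V i j * diff_op w \<sigma> r lam a b dx dy V i j) =
      \<sigma>\<^sup>2 / 2 / dx\<^sup>2 * (\<Sum>i\<in>?I. \<Sum>j\<in>?J. ?D i j) - (r + lam) * ?S
      + (\<Sum>i\<in>?I. \<Sum>j\<in>?J. V i j * upwind w a (\<lambda>i. V i j) i) / dx
      + (\<Sum>i\<in>?I. \<Sum>j\<in>?J. V i j * upwind w b (V i) j) / dy"
    unfolding split sum.distrib sum_subtractf sum_distrib_left[symmetric] sum_divide_distrib[symmetric] ..
  also have "\<dots> \<le> 0 - (r + lam) * ?S + ?W * (\<alpha> * dx) * ?S / dx + ?W * (\<beta> * dy) * ?S / dy"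
    using 1 2 3 pos by (intro add_mono diff_mono divide_right_mono mult_nonneg_nonpos) auto
  also have "\<dots> = (?W * (\<alpha> + \<beta>) - (r + lam)) * ?S"
    using pos by (simp add: field_simps)
  finally show ?thesis .
qed

section \<open>Norm bound for the jump part\<close>

text \<open>Jensen's inequality for total mass at most 1, obtained by expanding the nonnegative
  weighted variance about \<open>?m\<close>. The weights come in pairs because each cell feeds its
  two end nodes.\<close>

lemma convex_combination_square_le:
  fixes p q u v :: "'i \<Rightarrow> real"
  assumes nonneg: "\<And>k. k \<in> S \<Longrightarrow> 0 \<le> p k" "\<And>k. k \<in> S \<Longrightarrow> 0 \<le> q k"
    and sum: "(\<Sum>k\<in>S. p k + q k) \<le> 1"
  shows "(\<Sum>k\<in>S. p k * u k + q k * v k)\<^sup>2 \<le> (\<Sum>k\<in>S. p k * (u k)\<^sup>2 + q k * (v k)\<^sup>2)"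
proof -
  let ?m = "\<Sum>k\<in>S. p k * u k + q k * v k"
  have "0 \<le> (\<Sum>k\<in>S. p k * (u k - ?m)\<^sup>2 + q k * (v k - ?m)\<^sup>2)"
    by (intro sum_nonneg add_nonneg_nonneg mult_nonneg_nonneg nonneg) auto
  also have "\<dots> = (\<Sum>k\<in>S. (p k * (u k)\<^sup>2 + q k * (v k)\<^sup>2)
      - 2 * ?m * (p k * u k + q k * v k) + ?m\<^sup>2 * (p k + q k))"
    by (rule sum.cong) (auto simp: power2_eq_square algebra_simps)
  also have "\<dots> = (\<Sum>k\<in>S. p k * (u k)\<^sup>2 + q k * (v k)\<^sup>2) - 2 * ?m * ?m + ?m\<^sup>2 * (\<Sum>k\<in>S. p k + q k)"
  proof -
    have "(\<Sum>k\<in>S. F k - c * G k + d * H k) = sum F S - c * sum G S + d * sum H S"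
      for F G H :: "'i \<Rightarrow> real" and c d
      by (simp add: sum.distrib sum_subtractf sum_distrib_left)
    then show ?thesis .
  qed
  also have "\<dots> \<le> (\<Sum>k\<in>S. p k * (u k)\<^sup>2 + q k * (v k)\<^sup>2) - 2 * ?m * ?m + ?m\<^sup>2 * 1"
    using sum by (intro add_left_mono mult_left_mono) auto
  finally show ?thesis by (simp add: power2_eq_square)
qed

lemma prob_density_translate:
  assumes "prob_density f"
  shows "integrable lebesgue (\<lambda>\<xi>. f (\<xi> - s))" "(LINT \<xi>|lebesgue. f (\<xi> - s)) = 1"
proof -
  have f: "integrable lebesgue f" "integral\<^sup>L lebesgue f = 1"
    using assms by (auto simp: prob_density_def has_bochner_integral_iff)
  show "integrable lebesgue (\<lambda>\<xi>. f (\<xi> - s))"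
    using lebesgue_integrable_real_affine[of f 1 "-s"] f by simp
  show "(LINT \<xi>|lebesgue. f (\<xi> - s)) = 1"
    using lebesgue_integral_real_affine[of 1 f "-s"] f by simp
qed

lemma set_integrable_continuous_mult:
  fixes h g :: "real \<Rightarrow> real"
  assumes h: "continuous_on {p..q} h" and g: "integrable lebesgue g"
  shows "set_integrable lebesgue {p..q} (\<lambda>\<xi>. h \<xi> * g \<xi>)"
proof (rule absolutely_integrable_bounded_measurable_product_real)
  show "h \<in> borel_measurable (lebesgue_on {p..q})"
    using h by (intro continuous_imp_measurable_on_sets_lebesgue) auto
  show "bounded (h ` {p..q})"
    using compact_continuous_image[OF h] compact_imp_bounded by auto
  show "set_integrable lebesgue {p..q} g"
    unfolding set_integrable_def by (rule integrable_mult_indicator[OF _ g]) auto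
qed auto

text \<open>The antiderivative \<open>G\<close> is a parameter so that the integrals of the
  interpolation weights come out in closed form.\<close>

lemma set_integral_mult_le:
  fixes h g G :: "real \<Rightarrow> real"
  assumes h: "continuous_on {p..q} h" "\<And>\<xi>. \<xi> \<in> {p..q} \<Longrightarrow> 0 \<le> h \<xi>"
    and g: "integrable lebesgue g" "\<And>\<xi>. g \<xi> \<le> F"
    and G: "\<And>\<xi>. (G has_real_derivative h \<xi>) (at \<xi>)" and pq: "p \<le> q"
  shows "(LINT \<xi>:{p..q}|lebesgue. h \<xi> * g \<xi>) \<le> F * (G q - G p)"
proof -
  have abs: "set_integrable lebesgue {p..q} h"
    by (rule absolutely_integrable_continuous_real[OF h(1)])
  have "(LINT \<xi>:{p..q}|lebesgue. h \<xi> * g \<xi>) \<le> (LINT \<xi>:{p..q}|lebesgue. h \<xi> * F)"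
    using h g by (intro set_integral_mono set_integrable_continuous_mult set_integrable_mult_left abs)
      (auto intro!: mult_left_mono)
  also have "\<dots> = F * integral {p..q} h"
    using set_lebesgue_integral_eq_integral(2)[OF abs] by simp
  also have "integral {p..q} h = G q - G p"
    using G pq by (intro integral_unique fundamental_theorem_of_calculus)
      (auto simp: has_real_derivative_iff_has_vector_derivative[symmetric] intro: has_field_derivative_at_within)
  finally show ?thesis .
qed

lemma sum_set_integral_le:
  fixes g :: "real \<Rightarrow> real"
  assumes g: "integrable lebesgue g" "\<And>\<xi>. 0 \<le> g \<xi>" and y: "\<And>l. y l \<le> y (l + 1 :: int)"
  shows "(\<Sum>l\<in>{-1..int m}. LINT \<xi>:{y l..y (l+1)}|lebesgue. g \<xi>) \<le> integral\<^sup>L lebesgue g"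
proof -
  have g_int: "set_integrable lebesgue {p..q} g" for p q
    unfolding set_integrable_def by (rule integrable_mult_indicator[OF _ g(1)]) auto
  note hk = set_lebesgue_integral_eq_integral[OF g_int]
  \<comment> \<open>The ordering of the nodes is carried through the induction because combining
    integrals over adjacent intervals requires it.\<close>
  have "y (-1) \<le> y (int k) \<and> (\<Sum>l\<in>{-1..int k - 1}. LINT \<xi>:{y l..y (l+1)}|lebesgue. g \<xi>)
      = (LINT \<xi>:{y (-1)..y (int k)}|lebesgue. g \<xi>)" for k
  proof (induction k)
    case 0
    then show ?case using y[of "-1"] by simp
  next
    case (Suc k)
    have "{-1..int (Suc k) - 1} = insert (int k) {-1..int k - 1}" by auto
    then show ?case
      using Suc y[of "int k"] hk
        Henstock_Kurzweil_Integration.integral_combine[of "y (-1)" "y (int k)" "y (int k + 1)" g]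
      by (simp add: add.commute)
  qed
  from this[of "Suc m"] have "(\<Sum>l\<in>{-1..int m}. LINT \<xi>:{y l..y (l+1)}|lebesgue. g \<xi>)
      = (LINT \<xi>:{y (-1)..y (int m + 1)}|lebesgue. g \<xi>)"
    by (simp add: add.commute)
  also have "\<dots> \<le> integral\<^sup>L lebesgue g"
    unfolding set_lebesgue_integral_def using g
    by (intro integral_mono integrable_mult_indicator) (auto simp: indicator_def)
  finally show ?thesis .
qed

text \<open>A row applies weights \<open>p l\<close>, \<open>q l\<close> to the end nodes of cell
  \<open>l\<close>. Their sum is the mass of the translated density on the cell, so the total is at
  most 1 and Jensen's inequality applies.\<close>

lemma jump_op_square_le:
  assumes f: "prob_density f" and F: "\<And>\<xi>. f \<xi> \<le> F"
    and y: "\<And>l. y (l + 1) - y l = dy" and dy: "0 < dy"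
  shows "(jump_op lam f y dy m2 V i j)\<^sup>2
    \<le> lam\<^sup>2 * (F * dy / 2 * (\<Sum>l\<in>{-1..int m2}. (V i l)\<^sup>2 + (V i (l+1))\<^sup>2))"
proof -
  let ?L = "{-1..int m2}" and ?f = "\<lambda>\<xi>. f (\<xi> - y j)"
  define p where "p l = (LINT \<xi>:{y l..y (l+1)}|lebesgue. (y (l+1) - \<xi>) / dy * ?f \<xi>)" for l
  define q where "q l = (LINT \<xi>:{y l..y (l+1)}|lebesgue. (\<xi> - y l) / dy * ?f \<xi>)" for l
  note f_int = prob_density_translate[OF f, of "y j"]
  have f0: "0 \<le> ?f \<xi>" for \<xi> using f by (simp add: prob_density_def)
  have cont: "continuous_on S (\<lambda>\<xi>. (s - \<xi>) / dy)" "continuous_on S (\<lambda>\<xi>. (\<xi> - s) / dy)" for s S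
    using dy by (auto intro!: continuous_intros)
  note int = set_integrable_continuous_mult[OF cont(1) f_int(1)]
    set_integrable_continuous_mult[OF cont(2) f_int(1)]
  have y_le: "y l \<le> y (l + 1)" for l using y[of l] dy by simp
  have jump: "jump_op lam f y dy m2 V i j = lam * (\<Sum>l\<in>?L. p l * V i l + q l * V i (l+1))"
  proof -
    have "(LINT \<xi>:{y l..y (l+1)}|lebesgue. ((y (l+1) - \<xi>) / dy * u + (\<xi> - y l) / dy * v) * ?f \<xi>)
        = p l * u + q l * v" for l u v
    proof -
      have "(LINT \<xi>:{y l..y (l+1)}|lebesgue. ((y (l+1) - \<xi>) / dy * u + (\<xi> - y l) / dy * v) * ?f \<xi>)
          = (LINT \<xi>:{y l..y (l+1)}|lebesgue. (y (l+1) - \<xi>) / dy * ?f \<xi> * u + (\<xi> - y l) / dy * ?f \<xi> * v)"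
        by (simp add: algebra_simps)
      also have "\<dots> = p l * u + q l * v"
        unfolding p_def q_def using int
        by (subst set_integral_add(2)) (auto intro!: set_integrable_mult_left)
      finally show ?thesis .
    qed
    then show ?thesis by (simp add: jump_op_def)
  qed
  have p0: "0 \<le> p l" and q0: "0 \<le> q l" for l
    unfolding p_def q_def set_lebesgue_integral_def using dy f0
    by (auto intro!: Bochner_Integration.integral_nonneg simp: indicator_def)
  have pq: "p l + q l = (LINT \<xi>:{y l..y (l+1)}|lebesgue. ?f \<xi>)" for l
  proof -
    have "(y (l+1) - \<xi>) / dy * ?f \<xi> + (\<xi> - y l) / dy * ?f \<xi> = ?f \<xi>" for \<xi>
      using dy y[of l] by (simp add: distrib_right[symmetric] add_divide_distrib[symmetric])
    then show ?thesis
      unfolding p_def q_def by (subst set_integral_add(2)[OF int, symmetric]) simp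
  qed
  have half: "((y (l+1) - y l)\<^sup>2 / (2 * dy)) = dy / 2" for l
    using dy by (simp add: y power2_eq_square)
  \<comment> \<open>A linear weight falling from 1 to 0 has area \<open>dy / 2\<close> over the
    cell, and the density is at most \<open>F\<close>.\<close>
  have p_le: "p l \<le> F * dy / 2" for l
  proof -
    have "p l \<le> F * (- (y (l+1) - y (l+1))\<^sup>2 / (2 * dy) - - (y (l+1) - y l)\<^sup>2 / (2 * dy))"
      unfolding p_def using dy F
      by (intro set_integral_mult_le[where G = "\<lambda>\<xi>. - (y (l+1) - \<xi>)\<^sup>2 / (2 * dy)"] cont f_int y_le)
        (auto intro!: derivative_eq_intros simp: field_simps)
    then show ?thesis using half[of l] by simp
  qed
  have q_le: "q l \<le> F * dy / 2" for l
  proof -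
    have "q l \<le> F * ((y (l+1) - y l)\<^sup>2 / (2 * dy) - (y l - y l)\<^sup>2 / (2 * dy))"
      unfolding q_def using dy F
      by (intro set_integral_mult_le[where G = "\<lambda>\<xi>. (\<xi> - y l)\<^sup>2 / (2 * dy)"] cont f_int y_le)
        (auto intro!: derivative_eq_intros simp: field_simps)
    then show ?thesis using half[of l] by simp
  qed
  have "(\<Sum>l\<in>?L. p l * V i l + q l * V i (l+1))\<^sup>2 \<le> (\<Sum>l\<in>?L. p l * (V i l)\<^sup>2 + q l * (V i (l+1))\<^sup>2)"
    using p0 q0 sum_set_integral_le[where g = ?f and y = y and m = m2, OF f_int(1) f0 y_le] f_int(2)
    by (intro convex_combination_square_le) (auto simp: pq)
  also have "\<dots> \<le> (\<Sum>l\<in>?L. F * dy / 2 * (V i l)\<^sup>2 + F * dy / 2 * (V i (l+1))\<^sup>2)"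
    using p_le q_le by (intro sum_mono add_mono mult_right_mono) auto
  also have "\<dots> = F * dy / 2 * (\<Sum>l\<in>?L. (V i l)\<^sup>2 + (V i (l+1))\<^sup>2)"
    by (simp add: sum_distrib_left distrib_left)
  finally show ?thesis
    unfolding jump power_mult_distrib by (rule mult_left_mono) auto
qed

text \<open>Each interior node ends two cells, which turns \<open>dy / 2\<close> into
  \<open>dy\<close>. The row bound does not depend on \<open>j\<close>, so summing over
  \<open>j\<close> contributes the factor \<open>m2 + 1\<close>.\<close>

lemma jump_op_norm_le:
  assumes f: "prob_density f" and F: "\<And>\<xi>. f \<xi> \<le> F"
    and y: "\<And>l. y (l + 1) - y l = dy" and dy: "0 < dy"
    and supp: "\<And>i j. \<not> interior_node m1 m2 i j \<Longrightarrow> V i j = 0"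
  shows "(\<Sum>i\<in>{0..int m1}. \<Sum>j\<in>{0..int m2}. (jump_op lam f y dy m2 V i j)\<^sup>2)
    \<le> lam\<^sup>2 * (real (m2 + 1) * dy * F) * (\<Sum>i\<in>{0..int m1}. \<Sum>j\<in>{0..int m2}. (V i j)\<^sup>2)"
proof -
  let ?J = "{0..int m2}"
  have "(jump_op lam f y dy m2 V i j)\<^sup>2 \<le> lam\<^sup>2 * (F * dy * (\<Sum>l\<in>?J. (V i l)\<^sup>2))" for i j
  proof -
    have "(\<Sum>l\<in>{-1..int m2}. (V i (l + k))\<^sup>2) = (\<Sum>l\<in>?J. (V i l)\<^sup>2)" if "k \<in> {0,1}" for k
      using that by (intro sum_int_shift[where h = "\<lambda>l. (V i l)\<^sup>2"]) (auto simp: supp interior_node_def)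
    from this[of 0] this[of 1] show ?thesis
      using jump_op_square_le[where f = f and y = y, OF f F y dy, of lam m2 V i j] by (simp add: sum.distrib)
  qed
  then have "(\<Sum>i\<in>{0..int m1}. \<Sum>j\<in>?J. (jump_op lam f y dy m2 V i j)\<^sup>2)
      \<le> (\<Sum>i\<in>{0..int m1}. \<Sum>j\<in>?J. lam\<^sup>2 * (F * dy * (\<Sum>l\<in>?J. (V i l)\<^sup>2)))"
    by (intro sum_mono)
  also have "\<dots> = lam\<^sup>2 * (real (m2 + 1) * dy * F) * (\<Sum>i\<in>{0..int m1}. \<Sum>j\<in>?J. (V i j)\<^sup>2)"
    by (simp add: sum_distrib_left mult_ac add.commute)
  finally show ?thesis .
qed

section \<open>Coordinate vectors and grid functions\<close>

text \<open>Division with remainder by \<open>m2 + 1\<close> inverts the row-major numbering, so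
  double sums over the grid become inner products.\<close>

lemma scalar_prod_grid_vec:
  "scalar_prod (grid_vec m1 m2 U) (grid_vec m1 m2 W)
    = (\<Sum>i\<in>{0..int m1}. \<Sum>j\<in>{0..int m2}. U i j * W i j)"
proof -
  have bound: "nat i * (m2 + 1) + nat j < grid_dim m1 m2" if "i \<le> int m1" "j \<le> int m2" for i j
  proof -
    have "nat i * (m2 + 1) + nat j < nat i * (m2 + 1) + (m2 + 1)"
      using that by simp
    also have "\<dots> = (nat i + 1) * (m2 + 1)" by simp
    also have "\<dots> \<le> grid_dim m1 m2"
      unfolding grid_dim_def using that by (intro mult_right_mono) auto
    finally show ?thesis .
  qed
  have div_le: "k div (m2 + 1) \<le> m1" if "k < grid_dim m1 m2" for k
    using less_mult_imp_div_less[of k "m1 + 1" "m2 + 1"] that by (simp add: grid_dim_def)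
  have mod_le: "k mod (m2 + 1) \<le> m2" for k
    using mod_less_divisor[of "m2 + 1" k] by linarith
  have "scalar_prod (grid_vec m1 m2 U) (grid_vec m1 m2 W)
      = (\<Sum>k\<in>{0..<grid_dim m1 m2}. U (int (k div (m2 + 1))) (int (k mod (m2 + 1)))
           * W (int (k div (m2 + 1))) (int (k mod (m2 + 1))))"
    by (simp add: scalar_prod_def grid_vec_def)
  also have "\<dots> = (\<Sum>(i, j)\<in>{0..int m1} \<times> {0..int m2}. U i j * W i j)"
  proof (rule sum.reindex_bij_witness[of _ "\<lambda>(i, j). nat i * (m2 + 1) + nat j"
        "\<lambda>k. (int (k div (m2 + 1)), int (k mod (m2 + 1)))"])
    fix k assume "k \<in> {0..<grid_dim m1 m2}"
    then show "(int (k div (m2 + 1)), int (k mod (m2 + 1))) \<in> {0..int m1} \<times> {0..int m2}"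
      using div_le[of k] mod_le[of k] by simp
    show "(case (int (k div (m2 + 1)), int (k mod (m2 + 1))) of
        (i, j) \<Rightarrow> nat i * (m2 + 1) + nat j) = k"
      using div_mult_mod_eq[of k "m2 + 1"] by (simp del: add_Suc_right)
  next
    fix p assume "p \<in> {0..int m1} \<times> {0..int m2}"
    then obtain i j where p: "p = (int i, int j)" "i \<le> m1" "j \<le> m2"
      by (cases p) (auto elim!: nonneg_int_cases)
    show "(int ((case p of (i, j) \<Rightarrow> nat i * (m2 + 1) + nat j) div (m2 + 1)),
        int ((case p of (i, j) \<Rightarrow> nat i * (m2 + 1) + nat j) mod (m2 + 1))) = p"
      using p by (simp add: div_mult_self3 mod_mult_self3 del: mult_Suc_right add_Suc_right)
    show "(case p of (i, j) \<Rightarrow> nat i * (m2 + 1) + nat j) \<in> {0..<grid_dim m1 m2}"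
      using p bound[of "int i" "int j"] by simp
  qed auto
  also have "\<dots> = (\<Sum>i\<in>{0..int m1}. \<Sum>j\<in>{0..int m2}. U i j * W i j)"
    by (rule sum.cartesian_product[symmetric])
  finally show ?thesis .
qed

lemma grid_vec_zero_ext:
  assumes "V \<in> carrier_vec (grid_dim m1 m2)"
  shows "grid_vec m1 m2 (zero_ext m1 m2 V) = V"
proof (rule eq_vecI)
  fix k assume "k < dim_vec V"
  then have k: "k < grid_dim m1 m2" using assms by simp
  have "k div (m2 + 1) \<le> m1"
    using less_mult_imp_div_less[of k "m1 + 1" "m2 + 1"] k by (simp add: grid_dim_def)
  moreover have "k mod (m2 + 1) \<le> m2"
    using mod_less_divisor[of "m2 + 1" k] by linarith
  ultimately have "interior_node m1 m2 (int (k div (m2 + 1))) (int (k mod (m2 + 1)))"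
    by (simp add: interior_node_def)
  then show "vec_index (grid_vec m1 m2 (zero_ext m1 m2 V)) k = vec_index V k"
    using k div_mult_mod_eq[of k "m2 + 1"] by (simp add: grid_vec_def zero_ext_def del: add_Suc_right)
qed (use assms in \<open>simp add: grid_vec_def\<close>)

lemma scalar_prod_Cauchy_Schwarz:
  fixes v u :: "real Matrix.vec"
  assumes "dim_vec v = dim_vec u"
  shows "scalar_prod v u \<le> sqrt (scalar_prod v v) * sqrt (scalar_prod u u)"
proof -
  have "scalar_prod v u \<le> (\<Sum>i\<in>{0..<dim_vec u}. \<bar>vec_index v i\<bar> * \<bar>vec_index u i\<bar>)"
    unfolding scalar_prod_def by (intro sum_mono) (simp add: abs_mult[symmetric])
  also have "\<dots> \<le> L2_set (vec_index v) {0..<dim_vec u} * L2_set (vec_index u) {0..<dim_vec u}"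
    by (rule L2_set_mult_ineq)
  also have "\<dots> = sqrt (scalar_prod v v) * sqrt (scalar_prod u u)"
    using assms by (simp add: L2_set_def scalar_prod_def power2_eq_square)
  finally show ?thesis .
qed

lemma scalar_prod_self_nonneg: "0 \<le> scalar_prod v (v :: real Matrix.vec)"
  by (simp add: scalar_prod_def sum_nonneg)

section \<open>Contraction and convergence of the iteration\<close>

text \<open>Pair the equation with \<open>e\<close>, bound the right side by Cauchy-Schwarz and
  cancel one factor of the norm of \<open>e\<close>. The constant \<open>c\<close> may have either
  sign; \<open>h * c < 1\<close> makes the remaining factor positive.\<close>

lemma implicit_step_contraction:
  fixes A B :: "real Matrix.mat" and d e :: "real Matrix.vec"
  assumes A: "A \<in> carrier_mat N N" and B: "B \<in> carrier_mat N N"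
    and e: "e \<in> carrier_vec N" and d: "d \<in> carrier_vec N"
    and eq: "(1\<^sub>m N - h \<cdot>\<^sub>m A) *\<^sub>v e = h \<cdot>\<^sub>v (B *\<^sub>v d)"
    and energy: "scalar_prod e (A *\<^sub>v e) \<le> c * scalar_prod e e"
    and bound: "scalar_prod (B *\<^sub>v d) (B *\<^sub>v d) \<le> s\<^sup>2 * scalar_prod d d"
    and h: "0 \<le> h" and s: "0 \<le> s" and hc: "h * c < 1"
  shows "sqrt (scalar_prod e e) \<le> h * s / (1 - h * c) * sqrt (scalar_prod d d)"
proof -
  let ?n = "\<lambda>v. sqrt (scalar_prod v v)"
  have Ae: "A *\<^sub>v e \<in> carrier_vec N" and Bd: "B *\<^sub>v d \<in> carrier_vec N"
    using A B e d by auto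
  have "(1\<^sub>m N - h \<cdot>\<^sub>m A) *\<^sub>v e = e - h \<cdot>\<^sub>v (A *\<^sub>v e)"
  proof -
    have "(h \<cdot>\<^sub>m A) *\<^sub>v e = h \<cdot>\<^sub>v (A *\<^sub>v e)"
      using A e by (intro eq_vecI) (auto simp: scalar_prod_def sum_distrib_left mult.assoc)
    then show ?thesis
      using A e by (subst minus_mult_distrib_mat_vec[where nr = N and nc = N]) auto
  qed
  with eq have "scalar_prod e (e - h \<cdot>\<^sub>v (A *\<^sub>v e)) = scalar_prod e (h \<cdot>\<^sub>v (B *\<^sub>v d))"
    by simp
  then have "scalar_prod e e - h * scalar_prod e (A *\<^sub>v e) = h * scalar_prod e (B *\<^sub>v d)"
    using e Ae Bd by (simp add: scalar_prod_minus_distrib[where n = N])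
  moreover have "scalar_prod e (B *\<^sub>v d) \<le> ?n e * (s * ?n d)"
  proof -
    have "scalar_prod e (B *\<^sub>v d) \<le> ?n e * ?n (B *\<^sub>v d)"
      by (rule scalar_prod_Cauchy_Schwarz) (simp only: carrier_vecD[OF e] carrier_vecD[OF Bd])
    also have "?n (B *\<^sub>v d) \<le> s * ?n d"
      using real_sqrt_le_mono[OF bound] s by (simp add: real_sqrt_mult)
    finally show ?thesis by (simp add: mult_left_mono scalar_prod_self_nonneg)
  qed
  ultimately have "scalar_prod e e - h * (c * scalar_prod e e) \<le> h * (?n e * (s * ?n d))"
    using mult_left_mono[OF energy h] mult_left_mono[of "scalar_prod e (B *\<^sub>v d)" _ h] h
    by (smt (verit))
  moreover have "scalar_prod e e = ?n e * ?n e"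
    by (simp add: scalar_prod_self_nonneg)
  ultimately have "(1 - h * c) * ?n e * ?n e \<le> h * s * ?n d * ?n e"
    by (simp add: algebra_simps)
  then have "(1 - h * c) * ?n e \<le> h * s * ?n d"
  proof (cases "?n e = 0")
    case True
    then show ?thesis using h s scalar_prod_self_nonneg[of d] by (simp only: mult_zero_right) simp
  next
    case False
    then have "0 < ?n e" using real_sqrt_ge_zero[OF scalar_prod_self_nonneg[of e]] by linarith
    then show ?thesis
      using \<open>(1 - h * c) * ?n e * ?n e \<le> h * s * ?n d * ?n e\<close> by (rule mult_right_le_imp_le[rotated])
  qed
  then show ?thesis
    using hc by (simp add: field_simps)
qed

lemma geometric_contraction_tendsto_zero:
  fixes u :: "nat \<Rightarrow> real"
  assumes "\<And>l. 0 \<le> u l" and step: "\<And>l. u (Suc l) \<le> \<theta> * u l" and \<theta>: "0 \<le> \<theta>" "\<theta> < 1"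
  shows "u \<longlonglongrightarrow> 0"
proof (rule tendsto_sandwich)
  show "\<forall>\<^sub>F l in sequentially. 0 \<le> u l" using assms(1) by simp
  have "u l \<le> \<theta> ^ l * u 0" for l
  proof (induction l)
    case (Suc l)
    show ?case
      using step[of l] mult_left_mono[OF Suc \<theta>(1)] by (simp add: mult.assoc)
  qed simp
  then show "\<forall>\<^sub>F l in sequentially. u l \<le> \<theta> ^ l * u 0" by simp
  have "(\<lambda>l. \<theta> ^ l * u 0) \<longlonglongrightarrow> 0 * u 0"
    using \<theta> by (intro tendsto_mult LIMSEQ_realpow_zero tendsto_const)
  then show "(\<lambda>l. \<theta> ^ l * u 0) \<longlonglongrightarrow> 0" by simp
qed simp

theorem theorem5:
  fixes \<alpha> \<beta> \<sigma> lam dt \<mu> r :: real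
    and f :: "real \<Rightarrow> real"
    and w :: "int \<Rightarrow> real"
    and m1 m2 :: nat
    and x_min x_max y_min y_max dx dy L_y f_sup :: real
    and x y a b :: "int \<Rightarrow> real"
    and \<phi> :: "real \<Rightarrow> int \<Rightarrow> int \<Rightarrow> real"
    and A B :: "real Matrix.mat"
    and g :: "real \<Rightarrow> real Matrix.vec"
    and n N :: nat
    and V Y \<epsilon> :: "nat \<Rightarrow> real Matrix.vec"
    and C_tilde C_hat \<Theta> :: real
  assumes pos: "0 < \<alpha>" "0 < \<beta>" "0 < \<sigma>" "0 < lam" "0 < dt"
    and f_density: "prob_density f"
    and f_bounded: "bounded (range f)"
    and f_sup: "f_sup = (SUP \<xi>. \<bar>f \<xi>\<bar>)"
    and w_sum: "(\<Sum>k\<in>{-1..2::int}. w k) = 0"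
    and w_first: "(\<Sum>k\<in>{-1..2::int}. of_int k * w k) = 1"
    and w_second: "(\<Sum>k\<in>{-1..2::int}. of_int k ^ 2 * w k) = 0"
    and w2: "w 2 \<le> 0"
    and domain: "x_min < x_max" "y_min < y_max"
    and L_y: "L_y = y_max - y_min"
    and dx: "dx = (x_max - x_min) / real (m1 + 2)"
    and dy: "dy = (y_max - y_min) / real (m2 + 2)"
    and x: "\<And>i. x i = x_min + of_int (i + 1) * dx"
    and y: "\<And>j. y j = y_min + of_int (j + 1) * dy"
    and a: "\<And>i. a i = \<alpha> * (\<mu> - x i)"
    and b: "\<And>j. b j = - \<beta> * y j"
    and a_sign: "a 0 > 0" "0 > a (int m1)"
    and b_sign: "b 0 > 0" "0 > b (int m2)"
    and N: "N = grid_dim m1 m2"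
    and A: "A = grid_mat m1 m2 (diff_op w \<sigma> r lam a b dx dy)"
    and B: "B = grid_mat m1 m2 (jump_op lam f y dy m2)"
    and g: "\<And>t. g t = grid_vec m1 m2 (\<lambda>i j.
              diff_op w \<sigma> r lam a b dx dy (boundary_ext m1 m2 (\<phi> t)) i j
            + jump_op lam f y dy m2 (boundary_ext m1 m2 (\<phi> t)) i j)"
    and C_tilde: "C_tilde = (\<bar>w (-1)\<bar> - 10 * w 2) * (\<alpha> + \<beta>) - (r + lam)"
    and C_hat: "C_hat = C_tilde + lam * sqrt (L_y * f_sup)"
    and V_carrier: "\<And>k. k \<in> {n - 1..n + 1} \<Longrightarrow> V k \<in> carrier_vec N"
    and Y_carrier: "\<And>l. Y l \<in> carrier_vec N"
    and crank_nicolson: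
      "(1\<^sub>m N - (dt / 2) \<cdot>\<^sub>m A) *\<^sub>v V (n + 1) =
         (1\<^sub>m N + (dt / 2) \<cdot>\<^sub>m A) *\<^sub>v V n
         + (dt / 2) \<cdot>\<^sub>v (B *\<^sub>v V n + B *\<^sub>v V (n + 1))
         + (dt / 2) \<cdot>\<^sub>v (g (real n * dt) + g (real (n + 1) * dt))"
    and start: "Y 0 = (if n = 0 then V 0 else 2 \<cdot>\<^sub>v V n - V (n - 1))"
    and fixed_point:
      "\<And>l. l \<ge> 1 \<Longrightarrow>
         (1\<^sub>m N - (dt / 2) \<cdot>\<^sub>m A) *\<^sub>v Y l =
           (1\<^sub>m N + (dt / 2) \<cdot>\<^sub>m A) *\<^sub>v V n
           + (dt / 2) \<cdot>\<^sub>v (B *\<^sub>v V n + B *\<^sub>v Y (l - 1))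
           + (dt / 2) \<cdot>\<^sub>v (g (real n * dt) + g (real (n + 1) * dt))"
    and error: "\<And>l. \<epsilon> l = V (n + 1) - Y l"
    and \<Theta>: "\<Theta> = (dt / 2 * lam * sqrt (L_y * f_sup)) / (1 - dt / 2 * C_tilde)"
    and step: "C_hat * dt < 2"
  shows "(\<lambda>l. grid_norm dx dy (\<epsilon> l)) \<longlonglongrightarrow> 0 \<and>
         (\<forall>l\<ge>1. grid_norm dx dy (\<epsilon> l) \<le> \<Theta> * grid_norm dx dy (\<epsilon> (l - 1))) \<and>
         \<Theta> < 1"
proof -
  define s where "s = lam * sqrt (L_y * f_sup)"
  have dx0: "0 < dx" and dy0: "0 < dy" using domain by (simp_all add: dx dy)
  \<comment> \<open>Boundedness makes the real supremum a genuine upper bound.\<close>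
  have bdd: "bdd_above (range (\<lambda>\<xi>. \<bar>f \<xi>\<bar>))"
    using f_bounded by (auto simp: bounded_iff bdd_above_def)
  have f_le: "f \<xi> \<le> f_sup" for \<xi>
    using cSUP_upper[OF _ bdd, of \<xi>] by (simp add: f_sup)
  have f_sup0: "0 \<le> f_sup"
    using f_le[of 0] f_density by (auto simp: prob_density_def intro: order_trans)
  have L_y0: "0 \<le> L_y" using domain by (simp add: L_y)
  have s0: "0 \<le> s" using pos f_sup0 L_y0 by (simp add: s_def)
  have weights: "w (-1) = - w 2 - 1/2" "w 0 = 3 * w 2" "w 1 = 1/2 - 3 * w 2" "w 2 \<le> 0"
    using third_order_weights[OF w_sum w_first w_second] w2 by auto
  \<comment> \<open>The nodes are given by affine formulas on all integers, so these increments hold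
    beyond the grid as well, as the one-dimensional estimates require.\<close>
  have steps: "a i - a (i + 1) = \<alpha> * dx" "b j - b (j + 1) = \<beta> * dy" "y (j + 1) - y j = dy" for i j
    by (simp_all add: a b x y algebra_simps)
  have supp: "zero_ext m1 m2 U i j = 0" if "\<not> interior_node m1 m2 i j" for U i j
    using that by (simp add: zero_ext_def)
  have Am: "A \<in> carrier_mat N N" and Bm: "B \<in> carrier_mat N N"
    by (simp_all add: A B N grid_mat_def)
  have sp: "scalar_prod U U = (\<Sum>i\<in>{0..int m1}. \<Sum>j\<in>{0..int m2}. (zero_ext m1 m2 U i j)\<^sup>2)"
    if "U \<in> carrier_vec N" for U
    using that scalar_prod_grid_vec[of m1 m2 "zero_ext m1 m2 U" "zero_ext m1 m2 U"]
    by (simp add: grid_vec_zero_ext N power2_eq_square)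
  have energy: "scalar_prod U (A *\<^sub>v U) \<le> C_tilde * scalar_prod U U" if U: "U \<in> carrier_vec N" for U
  proof -
    have "A *\<^sub>v U = grid_vec m1 m2 (diff_op w \<sigma> r lam a b dx dy (zero_ext m1 m2 U))"
      unfolding A using U by (intro grid_mat_diff_op) (simp add: N)
    then have "scalar_prod U (A *\<^sub>v U) = (\<Sum>i\<in>{0..int m1}. \<Sum>j\<in>{0..int m2}.
        zero_ext m1 m2 U i j * diff_op w \<sigma> r lam a b dx dy (zero_ext m1 m2 U) i j)"
      using U scalar_prod_grid_vec[of m1 m2 "zero_ext m1 m2 U"]
      by (simp add: grid_vec_zero_ext N)
    also have "\<dots> \<le> C_tilde * scalar_prod U U"
      unfolding sp[OF U] C_tilde
      using pos dx0 dy0 by (intro diff_op_energy_le weights supp steps) auto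
    finally show ?thesis .
  qed
  have bound: "scalar_prod (B *\<^sub>v U) (B *\<^sub>v U) \<le> s\<^sup>2 * scalar_prod U U" if U: "U \<in> carrier_vec N" for U
  proof -
    have "B *\<^sub>v U = grid_vec m1 m2 (jump_op lam f y dy m2 (zero_ext m1 m2 U))"
      unfolding B using U f_density by (intro grid_mat_jump_op) (simp_all add: N)
    then have "scalar_prod (B *\<^sub>v U) (B *\<^sub>v U) =
        (\<Sum>i\<in>{0..int m1}. \<Sum>j\<in>{0..int m2}. (jump_op lam f y dy m2 (zero_ext m1 m2 U) i j)\<^sup>2)"
      by (simp add: scalar_prod_grid_vec power2_eq_square)
    also have "\<dots> \<le> lam\<^sup>2 * (real (m2 + 1) * dy * f_sup) * scalar_prod U U"
      unfolding sp[OF U] by (intro jump_op_norm_le f_density f_le steps dy0 supp)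
    also have "\<dots> \<le> lam\<^sup>2 * (L_y * f_sup) * scalar_prod U U"
    proof -
      \<comment> \<open>The interval has \<open>m2 + 2\<close> cells but only \<open>m2 + 1\<close>
        interior nodes, so the summed row bounds fall one cell short of \<open>L_y\<close>.\<close>
      have "real (m2 + 1) * dy \<le> real (m2 + 2) * dy" using dy0 by simp
      also have "\<dots> = L_y" by (simp add: dy L_y)
      finally show ?thesis
        using f_sup0 by (intro mult_right_mono mult_left_mono) (auto simp: scalar_prod_self_nonneg)
    qed
    also have "lam\<^sup>2 * (L_y * f_sup) = s\<^sup>2"
      using L_y0 f_sup0 by (simp add: s_def power_mult_distrib)
    finally show ?thesis .
  qed
  \<comment> \<open>Halving \<open>C_hat * dt < 2\<close> and rearranging gives the second
    inequality. As its left side is nonnegative, the denominator of \<open>\<Theta>\<close> is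
    positive, and dividing by it gives \<open>\<Theta> < 1\<close>.\<close>
  have Ct: "dt / 2 * C_tilde < 1" and lt: "dt / 2 * s < 1 - dt / 2 * C_tilde"
  proof -
    show 1: "dt / 2 * s < 1 - dt / 2 * C_tilde"
      using step by (simp add: C_hat s_def algebra_simps)
    have "0 \<le> dt / 2 * s" using pos s0 by simp
    with 1 show "dt / 2 * C_tilde < 1" by linarith
  qed
  have \<Theta>_s: "\<Theta> = dt / 2 * s / (1 - dt / 2 * C_tilde)"
    by (simp add: \<Theta> s_def mult.assoc)
  have \<Theta>0: "0 \<le> \<Theta>" and \<Theta>1: "\<Theta> < 1"
    using Ct lt s0 pos by (simp_all add: \<Theta>_s)
  have Vc: "V n \<in> carrier_vec N" "V (n + 1) \<in> carrier_vec N"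
    using V_carrier by auto
  have \<epsilon>c: "\<epsilon> l \<in> carrier_vec N" for l
    using Vc Y_carrier by (simp add: error)
  have contr: "grid_norm dx dy (\<epsilon> (Suc l)) \<le> \<Theta> * grid_norm dx dy (\<epsilon> l)" for l
  proof -
    let ?M = "1\<^sub>m N - (dt / 2) \<cdot>\<^sub>m A"
    let ?R = "(1\<^sub>m N + (dt / 2) \<cdot>\<^sub>m A) *\<^sub>v V n" and ?G = "(dt / 2) \<cdot>\<^sub>v (g (real n * dt) + g (real (n + 1) * dt))"
    have M: "?M \<in> carrier_mat N N" using Am by (intro minus_carrier_mat smult_carrier_mat)
    have R: "?R \<in> carrier_vec N" using Am Vc by (intro mult_mat_vec_carrier) auto
    have G: "?G \<in> carrier_vec N" by (simp add: g grid_vec_def N)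
    have Bc: "B *\<^sub>v V n \<in> carrier_vec N" "B *\<^sub>v V (n + 1) \<in> carrier_vec N" "B *\<^sub>v Y l \<in> carrier_vec N"
      using Bm Vc Y_carrier by auto
    \<comment> \<open>Subtracting the two schemes cancels the terms in \<open>V n\<close> and the
      boundary data; only the lagged jump term remains.\<close>
    have "?M *\<^sub>v \<epsilon> (Suc l) = ?M *\<^sub>v V (n + 1) - ?M *\<^sub>v Y (Suc l)"
      unfolding error using M Vc Y_carrier by (intro mult_minus_distrib_mat_vec)
    also have "\<dots> = (?R + (dt / 2) \<cdot>\<^sub>v (B *\<^sub>v V n + B *\<^sub>v V (n + 1)) + ?G)
        - (?R + (dt / 2) \<cdot>\<^sub>v (B *\<^sub>v V n + B *\<^sub>v Y l) + ?G)"
      using crank_nicolson fixed_point[of "Suc l"] by simp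
    also have "\<dots> = (dt / 2) \<cdot>\<^sub>v (B *\<^sub>v V (n + 1) - B *\<^sub>v Y l)"
      using R G Bc carrier_vecD[OF R] carrier_vecD[OF G] carrier_vecD[OF Bc(1)] carrier_vecD[OF Bc(2)] carrier_vecD[OF Bc(3)]
      by (intro eq_vecI) (auto simp: algebra_simps simp del: index_mult_mat_vec)
    also have "B *\<^sub>v V (n + 1) - B *\<^sub>v Y l = B *\<^sub>v \<epsilon> l"
      unfolding error using Bm Vc Y_carrier by (intro mult_minus_distrib_mat_vec[symmetric])
    finally have "sqrt (scalar_prod (\<epsilon> (Suc l)) (\<epsilon> (Suc l))) \<le> \<Theta> * sqrt (scalar_prod (\<epsilon> l) (\<epsilon> l))"
      unfolding \<Theta>_s using pos
      by (intro implicit_step_contraction[OF Am Bm \<epsilon>c \<epsilon>c _ energy[OF \<epsilon>c] bound[OF \<epsilon>c] _ s0 Ct]) auto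
    \<comment> \<open>The mesh weight in \<open>grid_norm\<close> is a common factor, so the
      Euclidean estimate transfers with the same \<open>\<Theta>\<close>.\<close>
    then have "sqrt (dx * dy) * sqrt (scalar_prod (\<epsilon> (Suc l)) (\<epsilon> (Suc l)))
        \<le> sqrt (dx * dy) * (\<Theta> * sqrt (scalar_prod (\<epsilon> l) (\<epsilon> l)))"
      using dx0 dy0 by (intro mult_left_mono) auto
    then show ?thesis
      by (simp only: grid_norm_def real_sqrt_mult[of "dx * dy"] mult.left_commute)
  qed
  have "(\<lambda>l. grid_norm dx dy (\<epsilon> l)) \<longlonglongrightarrow> 0"
    using contr \<Theta>0 \<Theta>1 dx0 dy0
    by (intro geometric_contraction_tendsto_zero[where \<theta> = \<Theta>])
       (auto simp: grid_norm_def scalar_prod_self_nonneg)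
  moreover have "\<forall>l\<ge>1. grid_norm dx dy (\<epsilon> l) \<le> \<Theta> * grid_norm dx dy (\<epsilon> (l - 1))"
  proof (intro allI impI)
    fix l :: nat assume "1 \<le> l"
    then show "grid_norm dx dy (\<epsilon> l) \<le> \<Theta> * grid_norm dx dy (\<epsilon> (l - 1))"
      using contr[of "l - 1"] by simp
  qed
  ultimately show ?thesis using \<Theta>1 by blast
qed

end
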